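(* Let $0\le v\le1$. Then $$\mathrm{S}(v,1)=\frac{\pi}{2}\int_0^v\frac{\sin^{-1}(x)}{x}\,dx-\frac{\mathrm{Li}_3(v)-\mathrm{Li}_3(-v)}{2}$$ and $$\begin{aligned}\mathrm{S}(v,v)=\;&\frac{\mathrm{Li}_3\left(e^{2i\sin^{-1}(v)}\right)+\mathrm{Li}_3\left(e^{-2i\sin^{-1}(v)}\right)}{4}-\frac{\zeta(3)}{2}\\&+\sin^{-1}(v)\,\frac{\mathrm{Li}_2\left(e^{2i\sin^{-1}(v)}\right)-\mathrm{Li}_2\left(e^{-2i\sin^{-1}(v)}\right)}{2i}+\left(\sin^{-1}(v)\right)^2\log(2v).\end{aligned}$$
   Context: The function $\mathrm{S}$ is $\mathrm{S}(v,w)=\int_0^1\frac{\sin^{-1}(vx)\sin^{-1}(wx)}{x}\,dx$. The polylogarithm is $\mathrm{Li}_k(z)=\sum_{n\ge1}z^n/n^k$ (for $k=2,3$ the series converges for $|z|\le1$). At $v=0$ the term $(\sin^{-1}(v))^2\log(2v)$ is read as its limit $0$. *)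

theory Defs
  imports "HOL-Analysis.Analysis"
begin

text \<open>
  The integrand is bounded and continuous on the half-open interval from 0 to 1, so its value at
  \<open>x = 0\<close> (which is 0, by the convention \<open>a / 0 = 0\<close>) does not affect the integral.
  Intended for parameters of absolute value at most 1, where \<^const>\<open>arcsin\<close> is the inverse sine.
\<close>
definition S_int :: "real \<Rightarrow> real \<Rightarrow> real" where
  "S_int v w = integral {0..1} (\<lambda>x. arcsin (v * x) * arcsin (w * x) / x)"

text \<open>
  The sum over \<open>n \<ge> 1\<close> is shifted to start at 0. Meaningful where the series converges;
  for \<open>k \<ge> 2\<close> this includes the closed unit disc.
\<close>
definition polylog :: "nat \<Rightarrow> 'a \<Rightarrow> 'a::{real_normed_field,banach}" where
  "polylog k z = (\<Sum>n. z ^ Suc n / of_nat (Suc n) ^ k)"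

text \<open>The Riemann zeta function at integers \<open>k \<ge> 2\<close>, where its Dirichlet series converges.\<close>
definition zeta_nat :: "nat \<Rightarrow> real" where
  "zeta_nat k = (\<Sum>n. 1 / real (Suc n) ^ k)"

text \<open>At \<open>v = 0\<close> the formal value of the logarithmic term agrees with its limit.\<close>
lemma arcsin_sq_ln_at_0: "(arcsin v)\<^sup>2 * ln (2 * v) = 0" if "v = (0::real)"
  using that by simp

end

theory Submission
  imports Defs "HOL-Real_Asymp.Real_Asymp"
begin

text \<open>
  For the first identity, expand \<open>arcsin (v x)\<close> in its power series, which converges uniformly up to
  \<open>x = 1\<close>, and integrate against \<open>x\<^sup>2\<^sup>k arcsin x\<close> termwise. The Wallis integral that appears is the
  reciprocal of the series coefficient, which cancels and leaves the odd part of the trilogarithm.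

  For the second identity, substitute \<open>x = sin u / v\<close>, so that the integral becomes that of
  \<open>u\<^sup>2 cot u\<close> up to \<open>arcsin v\<close>. Off the unit circle, at \<open>r e\<^sup>2\<^sup>i\<^sup>u\<close> with \<open>r < 1\<close>, the right-hand side is
  an antiderivative of \<open>2 r u\<^sup>2 sin (2 u) / (1 - 2 r cos (2 u) + r\<^sup>2)\<close>. These integrands are
  dominated by \<open>u\<^sup>2 cot u\<close> and converge to it as \<open>r\<close> tends to 1, while the dilogarithm and trilogarithm
  are continuous on the closed disc and the logarithmic term tends to \<open>u\<^sup>2 ln (2 sin u)\<close>.
\<close>

subsection \<open>Termwise integration\<close>

text \<open>The Weierstrass M-test makes the partial sums converge uniformly, and a uniform limit of
  continuous functions may be integrated by taking the limit of the integrals.\<close>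

lemma sums_integral:
  fixes f :: "nat \<Rightarrow> real \<Rightarrow> real"
  assumes "\<And>k. continuous_on {a..b} (f k)"
    and le: "\<And>k x. x \<in> {a..b} \<Longrightarrow> \<bar>f k x\<bar> \<le> M k" and "summable M"
    and g: "\<And>x. x \<in> {a..b} \<Longrightarrow> (\<lambda>k. f k x) sums g x"
  shows "(\<lambda>k. integral {a..b} (f k)) sums integral {a..b} g"
proof -
  have "uniform_limit {a..b} (\<lambda>n x. \<Sum>k<n. f k x) (\<lambda>x. \<Sum>k. f k x) sequentially"
    by (rule Weierstrass_m_test[OF _ \<open>summable M\<close>]) (use le in auto)
  then have "uniform_limit {a..b} (\<lambda>n x. \<Sum>k<n. f k x) g sequentially"
    by (rule uniform_limit_cong'[THEN iffD1, rotated 2]) (use g sums_unique in fastforce)+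
  then obtain I J where I: "\<And>n. ((\<lambda>x. \<Sum>k<n. f k x) has_integral I n) {a..b}"
      and J: "(g has_integral J) {a..b}" and lim: "I \<longlonglongrightarrow> J"
    by (rule uniform_limit_integral) (auto intro!: continuous_intros assms)
  have "((\<lambda>x. \<Sum>k<n. f k x) has_integral (\<Sum>k<n. integral {a..b} (f k))) {a..b}" for n
    by (intro has_integral_sum) (auto intro!: integrable_integral integrable_continuous_real assms)
  then have "I = (\<lambda>n. \<Sum>k<n. integral {a..b} (f k))"
    using I has_integral_unique by blast
  then show ?thesis
    using J lim by (simp add: sums_def integral_unique)
qed

lemma integral_power_from_0:
  fixes a :: real
  assumes "0 \<le> a"
  shows "integral {0..a} (\<lambda>x. c * x ^ n) = c * a ^ (n + 1) / real (n + 1)"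
proof -
  have "((\<lambda>x. c * x ^ n) has_integral (c / real (n + 1) * a ^ (n + 1) - c / real (n + 1) * 0 ^ (n + 1))) {0..a}"
  proof (rule fundamental_theorem_of_calculus[OF assms])
    fix x :: real
    have "((\<lambda>x. c / real (n + 1) * x ^ (n + 1)) has_real_derivative
        c / real (n + 1) * (real (n + 1) * x ^ (n + 1 - Suc 0))) (at x within {0..a})"
      by (intro DERIV_cmult DERIV_pow)
    then show "((\<lambda>x. c / real (n + 1) * x ^ (n + 1)) has_vector_derivative c * x ^ n) (at x within {0..a})"
      by (simp add: has_real_derivative_iff_has_vector_derivative)
  qed
  from integral_unique[OF this] show ?thesis
    by (simp del: integral_mult_right)
qed

lemma DERIV_sin_power:
  "((\<lambda>u::real. sin u ^ (n + 1)) has_real_derivative real (n + 1) * (cos u * sin u ^ n)) (at u within S)"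
  using DERIV_power[OF has_field_derivative_at_within[OF DERIV_sin], where n = "n + 1"] by simp

subsection \<open>The power series of the inverse sine\<close>

text \<open>The coefficient of \<open>x\<^sup>2\<^sup>k\<close> in the expansion of \<open>1 / sqrt (1 - x\<^sup>2)\<close>.\<close>
definition rsqrt_coeff :: "nat \<Rightarrow> real" where
  "rsqrt_coeff k = (- 1) ^ k * ((- 1 / 2) gchoose k)"

lemma rsqrt_coeff_0 [simp]: "rsqrt_coeff 0 = 1"
  by (simp add: rsqrt_coeff_def)

text \<open>This is the binomial recurrence (k + 1) C(a, k + 1) = (a - k) C(a, k) at a = -1/2. It
  carries the Wallis induction.\<close>

lemma rsqrt_coeff_Suc: "(2 * real k + 2) * rsqrt_coeff (Suc k) = (2 * real k + 1) * rsqrt_coeff k"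
proof -
  have "((- 1 / 2 :: real) gchoose Suc k) * (real k + 1) = ((- 1 / 2) gchoose k) * (- 1 / 2 - real k)"
    using gbinomial_mult_1[of "- 1 / 2 :: real" k] by (simp add: algebra_simps)
  \<comment> \<open>The factor \<open>- 2 * (- 1) ^ k\<close> clears the halves and supplies the
    sign of index \<open>Suc k\<close> on the left and of index \<open>k\<close> on the
    right.\<close>
  from arg_cong[OF this, of "\<lambda>t. - 2 * (- 1) ^ k * t"] show ?thesis
    by (simp add: rsqrt_coeff_def algebra_simps)
qed

lemma rsqrt_coeff_pos: "rsqrt_coeff k > 0"
proof (induction k)
  case (Suc k)
  then have "(2 * real k + 2) * rsqrt_coeff (Suc k) > 0"
    by (simp add: rsqrt_coeff_Suc)
  then show ?case
    by (simp add: zero_less_mult_iff)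
qed simp

text \<open>Binomial series with exponent -1/2 at the point -x^2; the sign in
  \<open>rsqrt_coeff\<close> absorbs the powers of -1.\<close>

lemma rsqrt_sums:
  fixes x :: real
  assumes "\<bar>x\<bar> < 1"
  shows "(\<lambda>k. rsqrt_coeff k * x ^ (2 * k)) sums inverse (sqrt (1 - x\<^sup>2))"
proof -
  have "x\<^sup>2 < 1"
    using assms by (simp add: abs_square_less_1)
  then have "(\<lambda>k. ((- 1 / 2) gchoose k) * (- (x\<^sup>2)) ^ k) sums (1 + - (x\<^sup>2)) powr (- 1 / 2)"
    by (intro gen_binomial_real) simp
  moreover have "((- 1 / 2) gchoose k) * (- (x\<^sup>2)) ^ k = rsqrt_coeff k * x ^ (2 * k)" for k
    by (simp add: rsqrt_coeff_def power_mult power_minus[of "x\<^sup>2"])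
  moreover have "(1 + - (x\<^sup>2)) powr (- 1 / 2) = inverse (sqrt (1 - x\<^sup>2))"
    using \<open>x\<^sup>2 < 1\<close> by (simp add: powr_minus powr_half_sqrt flip: minus_divide_left)
  ultimately show ?thesis
    by simp
qed

text \<open>The series of the derivative is integrated termwise over [0, x]. Its terms are positive
  and increasing in t, so the convergent series at t = x serves as majorant.\<close>

lemma arcsin_sums_less_1:
  assumes "0 \<le> x" "x < 1"
  shows "(\<lambda>k. rsqrt_coeff k / real (2 * k + 1) * x ^ (2 * k + 1)) sums arcsin x"
proof -
  have "(\<lambda>k. integral {0..x} (\<lambda>t. rsqrt_coeff k * t ^ (2 * k)))
      sums integral {0..x} (\<lambda>t. inverse (sqrt (1 - t\<^sup>2)))"
  proof (rule sums_integral)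
    show "\<bar>rsqrt_coeff k * t ^ (2 * k)\<bar> \<le> rsqrt_coeff k * x ^ (2 * k)" if "t \<in> {0..x}" for k t
      using that rsqrt_coeff_pos[of k] by (auto simp: abs_mult intro!: mult_left_mono power_mono)
    show "summable (\<lambda>k. rsqrt_coeff k * x ^ (2 * k))"
      using rsqrt_sums[of x] assms by (simp add: sums_iff)
    show "(\<lambda>k. rsqrt_coeff k * t ^ (2 * k)) sums inverse (sqrt (1 - t\<^sup>2))" if "t \<in> {0..x}" for t
      using that assms by (intro rsqrt_sums) auto
  qed (auto intro!: continuous_intros)
  moreover have "integral {0..x} (\<lambda>t. rsqrt_coeff k * t ^ (2 * k))
      = rsqrt_coeff k / real (2 * k + 1) * x ^ (2 * k + 1)" for k
    using integral_power_from_0[OF assms(1), of "rsqrt_coeff k" "2 * k"] by simp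
  moreover have "integral {0..x} (\<lambda>t. inverse (sqrt (1 - t\<^sup>2))) = arcsin x"
  proof -
    have "((\<lambda>t. inverse (sqrt (1 - t\<^sup>2))) has_integral (arcsin x - arcsin 0)) {0..x}"
    proof (rule fundamental_theorem_of_calculus[OF assms(1)])
      fix t assume "t \<in> {0..x}"
      then have "(arcsin has_real_derivative inverse (sqrt (1 - t\<^sup>2))) (at t within {0..x})"
        using assms by (intro has_field_derivative_at_within[OF DERIV_arcsin]) auto
      then show "(arcsin has_vector_derivative inverse (sqrt (1 - t\<^sup>2))) (at t within {0..x})"
        by (simp add: has_real_derivative_iff_has_vector_derivative)
    qed
    then show ?thesis
      by (simp add: integral_unique)
  qed
  ultimately show ?thesis
    by simp
qed

text \<open>For x < 1 each partial sum lies below arcsin x, hence below pi/2. A partial sum is a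
  polynomial in x, so the bound survives x tending to 1.\<close>

lemma summable_arcsin_coeff: "summable (\<lambda>k. rsqrt_coeff k / real (2 * k + 1))"
proof (rule summableI_nonneg_bounded)
  show "0 \<le> rsqrt_coeff k / real (2 * k + 1)" for k
    using rsqrt_coeff_pos[of k] by simp
  show "(\<Sum>k<n. rsqrt_coeff k / real (2 * k + 1)) \<le> pi / 2" for n
  proof -
    let ?p = "\<lambda>x::real. \<Sum>k<n. rsqrt_coeff k / real (2 * k + 1) * x ^ (2 * k + 1)"
    have "?p x \<le> pi / 2" if "x \<in> {0<..<1}" for x
    proof -
      have "?p x \<le> arcsin x"
      proof (rule sums_le[OF _ sums_If_finite_set arcsin_sums_less_1])
        show "(if k \<in> {..<n} then rsqrt_coeff k / real (2 * k + 1) * x ^ (2 * k + 1) else 0)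
            \<le> rsqrt_coeff k / real (2 * k + 1) * x ^ (2 * k + 1)" for k
          using that rsqrt_coeff_pos[of k] by simp
      qed (use that in auto)
      also have "\<dots> \<le> pi / 2"
        using that by (intro arcsin_ubound) auto
      finally show ?thesis .
    qed
    then have "eventually (\<lambda>x. ?p x \<le> pi / 2) (at_left 1)"
      by (auto simp: eventually_at_left_field intro!: exI[of _ 0])
    moreover have "(?p \<longlongrightarrow> ?p 1) (at_left 1)"
      by (intro tendsto_intros)
    ultimately have "?p 1 \<le> pi / 2"
      by (intro tendsto_upperbound) auto
    then show ?thesis
      by simp
  qed
qed

text \<open>Only x = 1 is new: summable coefficients make the sum continuous on [0, 1], and it
  agrees with the continuous function arcsin to the left of 1.\<close>

lemma arcsin_sums:
  assumes "0 \<le> x" "x \<le> 1"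
  shows "(\<lambda>k. rsqrt_coeff k / real (2 * k + 1) * x ^ (2 * k + 1)) sums arcsin x"
proof (cases "x < 1")
  case True
  with assms show ?thesis
    by (intro arcsin_sums_less_1)
next
  case False
  let ?f = "\<lambda>k x::real. rsqrt_coeff k / real (2 * k + 1) * x ^ (2 * k + 1)"
  have "uniform_limit {0..1} (\<lambda>n x. \<Sum>k<n. ?f k x) (\<lambda>x. \<Sum>k. ?f k x) sequentially"
  proof (rule Weierstrass_m_test[OF _ summable_arcsin_coeff])
    show "norm (?f k x) \<le> rsqrt_coeff k / real (2 * k + 1)" if "x \<in> {0..1}" for k x
      using that rsqrt_coeff_pos[of k] power_le_one[of x "2 * k + 1"]
      by (auto simp: abs_mult divide_right_mono mult_left_le)
  qed
  then have "continuous_on {0..1} (\<lambda>x. \<Sum>k. ?f k x)"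
    by (rule uniform_limit_theorem[rotated]) (auto intro!: always_eventually continuous_intros)
  then have "((\<lambda>x. \<Sum>k. ?f k x) \<longlongrightarrow> (\<Sum>k. ?f k 1)) (at_left 1)"
    by (auto simp: continuous_on_def at_within_Icc_at_left dest!: bspec[of _ _ 1])
  moreover have "((\<lambda>x. \<Sum>k. ?f k x) \<longlongrightarrow> arcsin 1) (at_left 1)"
  proof (rule Lim_transform_eventually)
    have "continuous_on {0..1::real} arcsin"
      by (rule continuous_on_subset[OF continuous_on_arcsin']) auto
    then show "(arcsin \<longlongrightarrow> arcsin 1) (at_left 1)"
      by (auto simp: continuous_on_def at_within_Icc_at_left dest!: bspec[of _ _ 1])
    show "eventually (\<lambda>x. arcsin x = (\<Sum>k. ?f k x)) (at_left 1)"
      using arcsin_sums_less_1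
      by (auto simp: eventually_at_left_field sums_iff simp del: of_nat_add of_nat_mult intro!: exI[of _ 0])
  qed
  ultimately have "(\<Sum>k. ?f k 1) = arcsin 1"
    by (intro tendsto_unique) auto
  moreover have "x = 1"
    using False assms by simp
  ultimately show ?thesis
    using summable_arcsin_coeff by (simp add: sums_iff)
qed

section \<open>Wallis integrals and the even moments of arcsin\<close>

text \<open>The function -cos u (sin u)^(2k+2) vanishes at both ends, so integrating its derivative
  relates consecutive integrals by the factor (2k+2)/(2k+3). By \<open>rsqrt_coeff_Suc\<close> the
  claimed values obey the same recursion.\<close>

lemma sin_power_odd_has_integral:
  "((\<lambda>u. sin u ^ (2 * k + 1)) has_integral 1 / ((2 * k + 1) * rsqrt_coeff k)) {0..pi / 2}"
proof (induction k)
  case 0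
  have "((\<lambda>u. sin u) has_integral (- cos (pi / 2) - - cos 0)) {0..pi / 2}"
    by (rule fundamental_theorem_of_calculus)
      (auto intro!: derivative_eq_intros simp flip: has_real_derivative_iff_has_vector_derivative)
  then show ?case
    by simp
next
  case (Suc k)
  have "((\<lambda>u. (2 * k + 3) * sin u ^ (2 * k + 3) - (2 * k + 2) * sin u ^ (2 * k + 1)) has_integral
      (- cos (pi / 2) * sin (pi / 2) ^ (2 * k + 2) - - cos 0 * sin 0 ^ (2 * k + 2))) {0..pi / 2}"
  proof (rule fundamental_theorem_of_calculus)
    fix u :: real
    have "((\<lambda>u. - cos u * sin u ^ (2 * k + 2)) has_real_derivative
        sin u * sin u ^ (2 * k + 2) - (2 * k + 2) * sin u ^ (2 * k + 1) * (cos u)\<^sup>2) (at u within {0..pi / 2})"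
      using DERIV_mult[OF DERIV_minus[OF has_field_derivative_at_within[OF DERIV_cos]] DERIV_sin_power[of "2 * k + 1"], of u "{0..pi / 2}"]
      by (simp add: power2_eq_square algebra_simps)
    also have "sin u * sin u ^ (2 * k + 2) - (2 * k + 2) * sin u ^ (2 * k + 1) * (cos u)\<^sup>2
        = (2 * k + 3) * sin u ^ (2 * k + 3) - (2 * k + 2) * sin u ^ (2 * k + 1)"
      unfolding cos_squared_eq by (simp add: algebra_simps power_add eval_nat_numeral)
    finally show "((\<lambda>u. - cos u * sin u ^ (2 * k + 2)) has_vector_derivative
        (2 * k + 3) * sin u ^ (2 * k + 3) - (2 * k + 2) * sin u ^ (2 * k + 1)) (at u within {0..pi / 2})"
      by (simp add: has_real_derivative_iff_has_vector_derivative)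
  qed simp
  \<comment> \<open>Adding 2k+2 times the induction hypothesis cancels the lower power of the
    sine.\<close>
  from has_integral_add[OF this has_integral_mult_right[OF Suc.IH, of "2 * k + 2"]]
  have "((\<lambda>u. (2 * k + 3) * sin u ^ (2 * k + 3)) has_integral
      (2 * k + 2) * (1 / ((2 * k + 1) * rsqrt_coeff k))) {0..pi / 2}"
    by (simp add: add_ac)
  from has_integral_mult_right[OF this, of "1 / (2 * k + 3)"]
  have "((\<lambda>u. sin u ^ (2 * k + 3)) has_integral
      1 / (2 * k + 3) * ((2 * k + 2) * (1 / ((2 * k + 1) * rsqrt_coeff k)))) {0..pi / 2}"
    by (simp add: field_simps del: of_nat_add of_nat_mult)
  also have "1 / (2 * k + 3) * ((2 * k + 2) * (1 / ((2 * k + 1) * rsqrt_coeff k)))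
      = 1 / ((2 * Suc k + 1) * rsqrt_coeff (Suc k))"
  proof -
    have "(2 * real k + 2) / ((2 * real k + 1) * rsqrt_coeff k) = 1 / rsqrt_coeff (Suc k)"
      unfolding rsqrt_coeff_Suc[symmetric] by simp
    then show ?thesis
      by (simp add: add.commute)
  qed
  finally show ?case
    by (simp add: eval_nat_numeral)
qed

text \<open>Substituting x = sin u and integrating by parts leaves the boundary term pi/2 minus a
  Wallis integral, both divided by 2k+1.\<close>

lemma integral_power_arcsin:
  "integral {0..1} (\<lambda>x. x ^ (2 * k) * arcsin x)
    = (pi / 2 - 1 / ((2 * k + 1) * rsqrt_coeff k)) / (2 * k + 1)"
proof -
  let ?c = "real (2 * k + 1)"
  have "((\<lambda>u. cos u *\<^sub>R (sin u ^ (2 * k) * arcsin (sin u))) has_integral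
      integral {sin 0..sin (pi / 2)} (\<lambda>x. x ^ (2 * k) * arcsin x)) {0..pi / 2}"
    by (rule has_integral_substitution[where c = 0 and d = 1])
      (auto intro!: continuous_intros derivative_eq_intros sin_ge_zero)
  then have *: "((\<lambda>u. u * (sin u ^ (2 * k) * cos u)) has_integral
      integral {0..1} (\<lambda>x. x ^ (2 * k) * arcsin x)) {0..pi / 2}"
    unfolding sin_zero sin_pi_half by (rule has_integral_eq[rotated]) (simp add: arcsin_sin)
  \<comment> \<open>Integration by parts: the integrand is the derivative of u (sin u)^(2k+1) /
    (2k+1).\<close>
  have "((\<lambda>u. sin u ^ (2 * k + 1) / ?c + u * (sin u ^ (2 * k) * cos u)) has_integral
      (pi / 2 * sin (pi / 2) ^ (2 * k + 1) / ?c - 0 * sin 0 ^ (2 * k + 1) / ?c)) {0..pi / 2}"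
  proof (rule fundamental_theorem_of_calculus)
    fix u :: real
    have "((\<lambda>u. u * sin u ^ (2 * k + 1) / ?c) has_real_derivative
        (1 * sin u ^ (2 * k + 1) + ?c * (cos u * sin u ^ (2 * k)) * u) / ?c) (at u within {0..pi / 2})"
      by (intro DERIV_cdivide DERIV_mult DERIV_ident DERIV_sin_power)
    also have "(1 * sin u ^ (2 * k + 1) + ?c * (cos u * sin u ^ (2 * k)) * u) / ?c
        = sin u ^ (2 * k + 1) / ?c + u * (sin u ^ (2 * k) * cos u)"
      by (simp add: add_divide_distrib del: of_nat_add of_nat_mult)
    finally show "((\<lambda>u. u * sin u ^ (2 * k + 1) / ?c) has_vector_derivative
        sin u ^ (2 * k + 1) / ?c + u * (sin u ^ (2 * k) * cos u)) (at u within {0..pi / 2})"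
      by (simp add: has_real_derivative_iff_has_vector_derivative)
  qed simp
  from has_integral_diff[OF this has_integral_divide[OF sin_power_odd_has_integral[of k], of ?c]]
  have "((\<lambda>u. u * (sin u ^ (2 * k) * cos u)) has_integral
      (pi / 2 - 1 / ((2 * k + 1) * rsqrt_coeff k)) / ?c) {0..pi / 2}"
    by (simp add: diff_divide_distrib add_ac)
  from has_integral_unique[OF * this] show ?thesis
    by (simp add: add_ac)
qed

lemma integral_arcsin_div_sums:
  assumes "0 \<le> v" "v \<le> 1"
  shows "(\<lambda>k. rsqrt_coeff k * v ^ (2 * k + 1) / real (2 * k + 1) ^ 2) sums
    integral {0..v} (\<lambda>x. arcsin x / x)"
proof -
  let ?c = "\<lambda>k. rsqrt_coeff k / real (2 * k + 1)"
  \<comment> \<open>The series has value 1 at 0, whereas \<open>arcsin 0 / 0\<close> is 0. Pointwise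
    convergence therefore needs the corrected function, which changes the integrand at a single
    point.\<close>
  let ?g = "\<lambda>x::real. if x = 0 then 1 else arcsin x / x"
  have "(\<lambda>k. integral {0..v} (\<lambda>x. ?c k * x ^ (2 * k))) sums integral {0..v} ?g"
  proof (rule sums_integral[OF _ _ summable_arcsin_coeff])
    fix x k assume x: "x \<in> {0..v}"
    show "\<bar>?c k * x ^ (2 * k)\<bar> \<le> ?c k"
      using x assms rsqrt_coeff_pos[of k] power_le_one[of x "2 * k"]
      by (auto simp: abs_mult divide_right_mono mult_left_le)
    show "(\<lambda>k. ?c k * x ^ (2 * k)) sums ?g x"
    proof (cases "x = 0")
      case True
      then show ?thesis
        using powser_sums_zero[of ?c] by (simp add: power_mult)
    next
      case False
      then show ?thesis
        using sums_divide[OF arcsin_sums[of x], of x] x assms by simp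
    qed
  qed (auto intro!: continuous_intros)
  moreover have "integral {0..v} (\<lambda>x. ?c k * x ^ (2 * k))
      = rsqrt_coeff k * v ^ (2 * k + 1) / real (2 * k + 1) ^ 2" for k
    using integral_power_from_0[OF assms(1), of "?c k" "2 * k"] by (simp add: power2_eq_square)
  moreover have "integral {0..v} ?g = integral {0..v} (\<lambda>x. arcsin x / x)"
    by (rule integral_spike[of "{0}"]) auto
  ultimately show ?thesis
    by simp
qed

subsection \<open>The polylogarithm\<close>

lemma norm_polylog_term_le:
  fixes z :: "'a::{real_normed_field,banach}"
  assumes "norm z \<le> 1"
  shows "norm (z ^ Suc n / of_nat (Suc n) ^ k) \<le> 1 / real (Suc n) ^ k"
proof -
  have "norm z ^ Suc n \<le> 1"
    using assms by (intro power_le_one) auto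
  then show ?thesis
    by (simp add: norm_divide norm_mult norm_power divide_right_mono del: of_nat_Suc power_Suc)
qed

lemma summable_inverse_Suc_power:
  assumes "k \<ge> 2"
  shows "summable (\<lambda>n. 1 / real (Suc n) ^ k)"
proof -
  have "summable (\<lambda>n. inverse (real (Suc n) ^ k))"
    by (subst summable_Suc_iff) (rule inverse_power_summable[OF assms])
  then show ?thesis
    by (simp only: inverse_eq_divide)
qed

lemma polylog_sums:
  fixes z :: "'a::{real_normed_field,banach}"
  assumes "k \<ge> 2" "norm z \<le> 1"
  shows "(\<lambda>n. z ^ Suc n / of_nat (Suc n) ^ k) sums polylog k z"
  unfolding polylog_def
  by (rule summable_sums[OF summable_comparison_test'[OF summable_inverse_Suc_power norm_polylog_term_le]])
    (use assms in auto)

text \<open>The bound 1/n^k is uniform on the closed disc. Continuity up to the boundary is what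
  permits the later passage from r < 1 to the unit circle.\<close>

lemma continuous_on_polylog:
  assumes "k \<ge> 2"
  shows "continuous_on (cball 0 1) (polylog k :: 'a::{real_normed_field,banach} \<Rightarrow> 'a)"
proof -
  have "uniform_limit (cball 0 1) (\<lambda>N z. \<Sum>n<N. z ^ Suc n / of_nat (Suc n) ^ k)
      (polylog k :: 'a \<Rightarrow> 'a) sequentially"
    unfolding polylog_def
    by (rule Weierstrass_m_test[OF norm_polylog_term_le summable_inverse_Suc_power]) (use assms in auto)
  then show ?thesis
    by (rule uniform_limit_theorem[rotated])
      (simp_all add: continuous_intros del: of_nat_Suc power_Suc)
qed

lemma polylog_odd_part_sums:
  fixes v :: real
  assumes "\<bar>v\<bar> \<le> 1" "k \<ge> 2"
  shows "(\<lambda>n. v ^ (2 * n + 1) / real (2 * n + 1) ^ k) sums ((polylog k v - polylog k (- v)) / 2)"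
proof -
  let ?t = "\<lambda>n. (v ^ Suc n / real (Suc n) ^ k - (- v) ^ Suc n / real (Suc n) ^ k) / 2"
  have "?t sums ((polylog k v - polylog k (- v)) / 2)"
    using assms by (intro sums_divide sums_diff polylog_sums) auto
  moreover have "?t n = 0" if "n \<notin> range (\<lambda>n. 2 * n)" for n
  proof -
    \<comment> \<open>Index n carries the exponent n + 1, so odd indices belong to the even powers,
      which cancel.\<close>
    have "odd n"
      using that by (auto elim!: evenE)
    then show ?thesis
      by simp
  qed
  ultimately have "(\<lambda>n. ?t (2 * n)) sums ((polylog k v - polylog k (- v)) / 2)"
    by (subst sums_mono_reindex) (auto simp: strict_mono_def)
  then show ?thesis
    by simp
qed

text \<open>The operator z d/dz multiplies the coefficient of z^n by n and so lowers the order by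
  one.\<close>

lemma DERIV_polylog:
  fixes z :: "'a::{real_normed_field,banach}"
  assumes "norm z < 1" "z \<noteq> 0"
  shows "(polylog (Suc k) has_field_derivative polylog k z / z) (at z)"
proof -
  \<comment> \<open>Undoing the index shift, with constant coefficient 0, gives an ordinary power
    series to which termwise differentiation applies.\<close>
  define c :: "nat \<Rightarrow> 'a" where "c n = (if n = 0 then 0 else 1 / of_nat n ^ Suc k)" for n
  have "summable (\<lambda>n. c n * w ^ n)" if "norm w < 1" for w
  proof (rule summable_comparison_test'[OF summable_geometric])
    show "norm (norm w) < 1"
      using that by simp
    show "norm (c n * w ^ n) \<le> norm w ^ n" for n
    proof (cases n)
      case (Suc m)
      have "(1::real) \<le> real n ^ Suc k"
        using Suc by (intro one_le_power) auto
      then have "norm (c n) \<le> 1"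
        using Suc by (simp add: c_def norm_divide norm_mult norm_power divide_le_eq_1 del: of_nat_Suc)
      then show ?thesis
        by (simp add: norm_mult norm_power mult_left_le_one_le)
    qed (simp add: c_def)
  qed
  note c_summable = this
  have polylog_c: "polylog (Suc k) w = (\<Sum>n. c n * w ^ n)" if "norm w < 1" for w
    using suminf_split_head[OF c_summable[OF that]]
    by (simp add: polylog_def c_def del: power_Suc of_nat_Suc)
  have "((\<lambda>w. \<Sum>n. c n * w ^ n) has_field_derivative (\<Sum>n. diffs c n * z ^ n)) (at z)"
    by (rule termdiffs_strong'[OF c_summable]) (use assms in auto)
  then have "(polylog (Suc k) has_field_derivative (\<Sum>n. diffs c n * z ^ n)) (at z)"
  proof (rule has_field_derivative_transform_within_open[where S = "ball 0 1"])
    show "(\<Sum>n. c n * w ^ n) = polylog (Suc k) w" if "w \<in> ball 0 1" for w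
      using that by (simp add: polylog_c)
  qed (use assms in auto)
  moreover have "(\<Sum>n. diffs c n * z ^ n) = polylog k z / z"
  proof -
    have "summable (\<lambda>n. diffs c n * z ^ n)"
      by (rule termdiff_converges[OF assms(1) c_summable])
    then have "(\<Sum>n. diffs c n * z ^ n) * z = (\<Sum>n. diffs c n * z ^ n * z)"
      by (rule suminf_mult2)
    also have "(\<lambda>n. diffs c n * z ^ n * z) = (\<lambda>n. z ^ Suc n / of_nat (Suc n) ^ k)"
      by (rule ext) (simp add: diffs_def c_def del: of_nat_Suc)
    finally show ?thesis
      unfolding polylog_def[symmetric] using assms by (metis nonzero_eq_divide_eq)
  qed
  ultimately show ?thesis
    by simp
qed

lemma polylog_0: "norm z < 1 \<Longrightarrow> polylog 0 z = z / (1 - z)"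
  for z :: "'a::{real_normed_field,banach}"
  using suminf_mult[OF summable_geometric, of z z] by (simp add: polylog_def suminf_geometric)

lemma polylog_1_complex:
  assumes "cmod z < 1"
  shows "polylog 1 z = - Ln (1 - z)"
proof -
  have "(\<lambda>n. - (z ^ n) / of_nat n) sums Ln (1 - z)"
    using Ln_series'[of "- z"] assms by simp
  then have "(\<lambda>n. - (z ^ Suc n) / of_nat (Suc n)) sums Ln (1 - z)"
    \<comment> \<open>The dropped term at n = 0 is a division by zero and hence 0.\<close>
    by (subst sums_Suc_iff) simp
  from sums_minus[OF this] show ?thesis
    by (simp add: polylog_def sums_iff)
qed


subsection \<open>The integral with one parameter equal to one\<close>

text \<open>The expansion of arcsin (v x) is integrated against arcsin x / x. In each moment from
  \<open>integral_power_arcsin\<close> the first part builds the integral of arcsin x / x, the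
  second the odd part of the trilogarithm.\<close>

lemma S_int_1:
  assumes "0 \<le> v" "v \<le> 1"
  shows "S_int v 1 = pi / 2 * integral {0..v} (\<lambda>x. arcsin x / x) - (polylog 3 v - polylog 3 (- v)) / 2"
proof -
  let ?c = "\<lambda>k. rsqrt_coeff k / real (2 * k + 1)"
  let ?f = "\<lambda>k x. ?c k * v ^ (2 * k + 1) * (x ^ (2 * k) * arcsin x)"
  have "(\<lambda>k. integral {0..1} (?f k)) sums integral {0..1} (\<lambda>x. arcsin (v * x) * arcsin (1 * x) / x)"
  proof (rule sums_integral)
    fix x :: real and k assume x: "x \<in> {0..1}"
    have arcsin_x: "0 \<le> arcsin x" "arcsin x \<le> pi / 2"
      using x arcsin_nonneg arcsin_ubound by auto
    have "\<bar>?f k x\<bar> = ?c k * (v ^ (2 * k + 1) * (x ^ (2 * k) * arcsin x))"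
      using assms x arcsin_x rsqrt_coeff_pos[of k] by (simp add: abs_mult)
    also have "\<dots> \<le> ?c k * (1 * (1 * (pi / 2)))"
      using assms x arcsin_x rsqrt_coeff_pos[of k]
      by (intro mult_left_mono mult_mono power_le_one) auto
    finally show "\<bar>?f k x\<bar> \<le> ?c k * (pi / 2)"
      by simp
    show "(\<lambda>k. ?f k x) sums (arcsin (v * x) * arcsin (1 * x) / x)"
    proof (cases "x = 0")
      case False
      have "(\<lambda>k. ?c k * (v * x) ^ (2 * k + 1) * (arcsin x / x)) sums (arcsin (v * x) * (arcsin x / x))"
        using x assms by (intro sums_mult2 arcsin_sums) (auto simp: mult_le_one)
      then show ?thesis
        using False by (simp add: power_mult_distrib mult_ac)
    qed simp
  next
    show "continuous_on {0..1} (?f k)" for k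
      by (intro continuous_intros) auto
    show "summable (\<lambda>k. ?c k * (pi / 2))"
      by (rule summable_mult2[OF summable_arcsin_coeff])
  qed
  moreover have "integral {0..1} (?f k)
      = pi / 2 * (rsqrt_coeff k * v ^ (2 * k + 1) / real (2 * k + 1) ^ 2) - v ^ (2 * k + 1) / real (2 * k + 1) ^ 3" for k
  proof -
    have "integral {0..1} (?f k) = ?c k * v ^ (2 * k + 1) * integral {0..1} (\<lambda>x. x ^ (2 * k) * arcsin x)"
      by (rule integral_mult_right)
    also have "\<dots> = ?c k * v ^ (2 * k + 1) * ((pi / 2 - 1 / (real (2 * k + 1) * rsqrt_coeff k)) / real (2 * k + 1))"
      unfolding integral_power_arcsin by (simp add: add_ac)
    also have "\<dots> = pi / 2 * (rsqrt_coeff k * v ^ (2 * k + 1) / real (2 * k + 1) ^ 2) - v ^ (2 * k + 1) / real (2 * k + 1) ^ 3"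
    proof -
      \<comment> \<open>Here a is the series coefficient and m is 2k+1; a cancels against the
        reciprocal in the Wallis integral.\<close>
      have *: "a / m * p * ((b - 1 / (m * a)) / m) = b * (a * p / m ^ 2) - p / m ^ 3"
        if "a \<noteq> 0" "m \<noteq> 0" for a m p b :: real
        using that by (simp add: field_simps power2_eq_square power3_eq_cube)
      show ?thesis
        using rsqrt_coeff_pos[of k] by (intro *) auto
    qed
    finally show ?thesis .
  qed
  moreover have "(\<lambda>k. pi / 2 * (rsqrt_coeff k * v ^ (2 * k + 1) / real (2 * k + 1) ^ 2)
      - v ^ (2 * k + 1) / real (2 * k + 1) ^ 3) sums
      (pi / 2 * integral {0..v} (\<lambda>x. arcsin x / x) - (polylog 3 v - polylog 3 (- v)) / 2)"
    using assms by (intro sums_diff sums_mult integral_arcsin_div_sums polylog_odd_part_sums) auto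
  ultimately show ?thesis
    unfolding S_int_def using sums_unique2 by simp
qed

subsection \<open>The integral with equal parameters\<close>

text \<open>With x = sin u / v the factor v cancels between dx = cos u / v du and 1/x, leaving u^2
  cos u / sin u.\<close>

lemma integral_arcsin_sq_substitution:
  assumes "0 < v" "v \<le> 1"
  shows "((\<lambda>u. u\<^sup>2 * cot u) has_integral S_int v v) {0..arcsin v}"
proof -
  let ?f = "\<lambda>x. arcsin (v * x) * arcsin (v * x) / x"
  \<comment> \<open>Only x = 0 is delicate: arcsin (v x) / x tends to the derivative v while the
    other factor tends to 0, so the limit is the conventional value 0.\<close>
  have "continuous_on {0..1} ?f"
    unfolding continuous_on_def
  proof
    fix x :: real assume x: "x \<in> {0..1}"
    have arcsin_cont: "continuous_on {0..1} (\<lambda>x. arcsin (v * x))"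
      using assms by (intro continuous_intros) (auto simp: mult_le_one intro: order_trans[of _ 0])
    then have arcsin_lim: "((\<lambda>x. arcsin (v * x)) \<longlongrightarrow> arcsin (v * x)) (at x within {0..1})"
      using x by (auto simp: continuous_on_def)
    show "(?f \<longlongrightarrow> ?f x) (at x within {0..1})"
    proof (cases "x = 0")
      case False
      then show ?thesis
        by (intro tendsto_intros arcsin_lim)
    next
      case True
      have "((\<lambda>x. arcsin (v * x)) has_real_derivative inverse (sqrt (1 - 0\<^sup>2)) * (v * 1)) (at 0)"
        by (rule DERIV_chain2[where f = arcsin, OF _ DERIV_cmult[OF DERIV_ident]])
          (use DERIV_arcsin[of 0] in auto)
      then have "((\<lambda>x. arcsin (v * x) / x) \<longlongrightarrow> v) (at 0)"
        by (simp add: DERIV_def)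
      then have "((\<lambda>x. arcsin (v * x) / x) \<longlongrightarrow> v) (at 0 within {0..1})"
        by (rule tendsto_within_subset) simp
      from tendsto_mult[OF arcsin_lim[unfolded True] this] show ?thesis
        using True by simp
    qed
  qed
  moreover have "0 \<le> arcsin v" "arcsin v \<le> pi / 2"
    using assms arcsin_nonneg[of v] arcsin_ubound[of v] by auto
  \<comment> \<open>This keeps sin u / v inside [0, 1].\<close>
  moreover have "sin u \<le> v" if "0 \<le> u" "u \<le> arcsin v" for u
    using that assms le_arcsin_iff[of v u] calculation(3) by auto
  ultimately have "((\<lambda>u. (cos u / v) *\<^sub>R ?f (sin u / v)) has_integral
      integral {sin 0 / v..sin (arcsin v) / v} ?f) {0..arcsin v}"
    using assms
    by (intro has_integral_substitution[where c = 0 and d = 1])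
      (auto intro!: derivative_eq_intros divide_nonneg_nonneg sin_ge_zero simp: divide_le_eq_1)
  then have "((\<lambda>u. (cos u / v) *\<^sub>R ?f (sin u / v)) has_integral S_int v v) {0..arcsin v}"
    using assms by (simp add: S_int_def)
  then show ?thesis
  proof (rule has_integral_eq[rotated])
    fix u assume "u \<in> {0..arcsin v}"
    then have "arcsin (sin u) = u"
      using \<open>arcsin v \<le> pi / 2\<close> by (intro arcsin_sin) auto
    then show "(cos u / v) *\<^sub>R ?f (sin u / v) = u\<^sup>2 * cot u"
      using assms by (simp add: cot_def power2_eq_square)
  qed
qed

section \<open>The antiderivative inside the unit disc\<close>

definition circ :: "real \<Rightarrow> complex \<Rightarrow> complex" where
  "circ r t = of_real r * exp (2 * \<i> * t)"

text \<open>
  The factor \<open>- polylog 1\<close> plays the role of the logarithm: on the unit circle the last summand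
  becomes \<open>t\<^sup>2 ln (2 sin t)\<close>.
\<close>
definition clausen_prim :: "real \<Rightarrow> complex \<Rightarrow> complex" where
  "clausen_prim r t = (polylog 3 (circ r t) + polylog 3 (circ r (- t))) / 4
     + t * ((polylog 2 (circ r t) - polylog 2 (circ r (- t))) / (2 * \<i>))
     - t\<^sup>2 / 2 * (polylog 1 (circ r t) + polylog 1 (circ r (- t)))"

lemma norm_circ_of_real [simp]: "norm (circ r (of_real u)) = \<bar>r\<bar>" "norm (circ r (- of_real u)) = \<bar>r\<bar>"
proof -
  have "norm (exp (2 * \<i> * of_real u)) = 1" for u
    by (simp add: norm_exp_eq_Re)
  from this[of u] this[of "- u"]
  show "norm (circ r (of_real u)) = \<bar>r\<bar>" "norm (circ r (- of_real u)) = \<bar>r\<bar>"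
    by (simp_all add: circ_def norm_mult)
qed

lemma circ_eq_0_iff [simp]: "circ r t = 0 \<longleftrightarrow> r = 0"
  by (simp add: circ_def)

text \<open>The inner derivative 2 i z cancels the division by z in
  \<open>DERIV_polylog\<close>.\<close>

lemma DERIV_polylog_circ:
  assumes "\<bar>r\<bar> < 1" "r \<noteq> 0"
  shows "((\<lambda>t. polylog (Suc k) (circ r t)) has_field_derivative 2 * \<i> * polylog k (circ r (of_real u))) (at (of_real u))"
    and "((\<lambda>t. polylog (Suc k) (circ r (- t))) has_field_derivative - (2 * \<i> * polylog k (circ r (- of_real u)))) (at (of_real u))"
proof -
  have circ: "(circ r has_field_derivative 2 * \<i> * circ r t) (at t)" for t
    unfolding circ_def[abs_def] by (auto intro!: derivative_eq_intros)
  show "((\<lambda>t. polylog (Suc k) (circ r t)) has_field_derivative 2 * \<i> * polylog k (circ r (of_real u))) (at (of_real u))"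
    by (rule DERIV_cong[OF DERIV_chain2[OF DERIV_polylog circ]]) (use assms in auto)
  show "((\<lambda>t. polylog (Suc k) (circ r (- t))) has_field_derivative - (2 * \<i> * polylog k (circ r (- of_real u)))) (at (of_real u))"
    by (rule DERIV_cong[OF DERIV_chain2[OF DERIV_polylog DERIV_chain2[OF circ DERIV_minus[OF DERIV_ident]]]])
      (use assms in auto)
qed

text \<open>The contributions of orders 2 and 1 telescope between neighbouring summands, so only the
  order 0 part of the last summand remains.\<close>

lemma DERIV_clausen_prim:
  assumes "\<bar>r\<bar> < 1" "r \<noteq> 0"
  shows "(clausen_prim r has_field_derivative
    - \<i> * of_real (u\<^sup>2) * (polylog 0 (circ r (of_real u)) - polylog 0 (circ r (- of_real u)))) (at (of_real u))"
proof -
  have Suc_eqs: "Suc 2 = 3" "Suc 1 = 2" "Suc 0 = 1"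
    by simp_all
  note D = DERIV_polylog_circ[OF assms, of 2 u, unfolded Suc_eqs] DERIV_polylog_circ[OF assms, of 1 u, unfolded Suc_eqs]
    DERIV_polylog_circ[OF assms, of 0 u, unfolded Suc_eqs]
  have D3: "((\<lambda>t. (polylog 3 (circ r t) + polylog 3 (circ r (- t))) / 4) has_field_derivative
      (2 * \<i> * polylog 2 (circ r (of_real u)) + - (2 * \<i> * polylog 2 (circ r (- of_real u)))) / 4) (at (of_real u))"
    by (intro DERIV_cdivide DERIV_add D)
  have D2: "((\<lambda>t. t * ((polylog 2 (circ r t) - polylog 2 (circ r (- t))) / (2 * \<i>))) has_field_derivative
      1 * ((polylog 2 (circ r (of_real u)) - polylog 2 (circ r (- of_real u))) / (2 * \<i>))
      + (2 * \<i> * polylog 1 (circ r (of_real u)) - - (2 * \<i> * polylog 1 (circ r (- of_real u)))) / (2 * \<i>) * of_real u)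
      (at (of_real u))"
    by (intro DERIV_mult DERIV_cdivide DERIV_diff DERIV_ident D)
  have D1: "((\<lambda>t. t\<^sup>2 / 2 * (polylog 1 (circ r t) + polylog 1 (circ r (- t)))) has_field_derivative
      of_real u * (polylog 1 (circ r (of_real u)) + polylog 1 (circ r (- of_real u)))
      + (2 * \<i> * polylog 0 (circ r (of_real u)) + - (2 * \<i> * polylog 0 (circ r (- of_real u)))) * ((of_real u)\<^sup>2 / 2))
      (at (of_real u))"
  proof (intro DERIV_mult)
    show "((\<lambda>t. t\<^sup>2 / 2 :: complex) has_field_derivative of_real u) (at (of_real u))"
      by (auto intro!: derivative_eq_intros)
    show "((\<lambda>t. polylog 1 (circ r t) + polylog 1 (circ r (- t))) has_field_derivative
      (2 * \<i> * polylog 0 (circ r (of_real u)) + - (2 * \<i> * polylog 0 (circ r (- of_real u))))) (at (of_real u))"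
      by (intro DERIV_add D)
  qed
  show ?thesis
    unfolding clausen_prim_def[abs_def]
    by (rule DERIV_cong[OF DERIV_diff[OF DERIV_add[OF D3 D2] D1]])
      (simp add: field_simps)
qed

text \<open>For the conjugate points z and w, z/(1-z) - w/(1-w) = (z-w)/((1-z)(1-w)). The result is
  the conjugate Poisson kernel at the angle 2u.\<close>

lemma polylog_0_circ_diff:
  assumes "\<bar>r\<bar> < 1"
  shows "- \<i> * (polylog 0 (circ r (of_real u)) - polylog 0 (circ r (- of_real u)))
    = of_real (2 * r * sin (2 * u) / (1 - 2 * r * cos (2 * u) + r\<^sup>2))"
proof -
  let ?z = "circ r (of_real u)" and ?w = "circ r (- of_real u)"
  have z: "?z = of_real r * (of_real (cos (2 * u)) + \<i> * of_real (sin (2 * u)))"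
    using cis_conv_exp[of "2 * u"] by (simp add: circ_def cis.ctr complex_eq_iff exp_eq_polar mult_ac)
  have w: "?w = of_real r * (of_real (cos (2 * u)) - \<i> * of_real (sin (2 * u)))"
    using cis_conv_exp[of "- (2 * u)"] by (simp add: circ_def cis.ctr complex_eq_iff exp_eq_polar mult_ac)
  have "1 - ?z \<noteq> 0" "1 - ?w \<noteq> 0"
    using assms norm_circ_of_real[of r u] by (auto simp del: norm_circ_of_real)
  then have "?z / (1 - ?z) - ?w / (1 - ?w) = (?z - ?w) / ((1 - ?z) * (1 - ?w))"
    by (simp add: field_simps)
  also have "?z - ?w = 2 * \<i> * of_real (r * sin (2 * u))"
    unfolding z w by (simp add: algebra_simps)
  also have "(1 - ?z) * (1 - ?w) = of_real (1 - 2 * r * cos (2 * u) + r\<^sup>2)"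
  proof -
    have "(cos (2 * u))\<^sup>2 = 1 - (sin (2 * u))\<^sup>2"
      by (rule cos_squared_eq)
    then show ?thesis
      unfolding z w complex_eq_iff
      by simp algebra
  qed
  finally have "- \<i> * (?z / (1 - ?z) - ?w / (1 - ?w))
      = - \<i> * (2 * \<i> * of_real (r * sin (2 * u)) / of_real (1 - 2 * r * cos (2 * u) + r\<^sup>2))"
    by simp
  also have "\<dots> = of_real (2 * r * sin (2 * u) / (1 - 2 * r * cos (2 * u) + r\<^sup>2))"
  proof -
    have "- \<i> * (2 * \<i> * x / y) = 2 * x / y" for x y :: complex
      by (cases "y = 0") (simp_all add: field_simps)
    then show ?thesis
      by (simp only: of_real_mult of_real_divide of_real_numeral mult.assoc)
  qed
  finally show ?thesis
    using assms by (simp add: polylog_0)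
qed


text \<open>At 0 both circle points equal r and the summands with a factor t vanish, so the lower
  limit contributes half of Li_3(r), the source of zeta(3)/2.\<close>

lemma clausen_prim_has_integral:
  assumes "0 < r" "r < 1" "0 \<le> b"
  shows "((\<lambda>u. complex_of_real (u\<^sup>2 * (2 * r * sin (2 * u) / (1 - 2 * r * cos (2 * u) + r\<^sup>2)))) has_integral
    clausen_prim r (of_real b) - polylog 3 (of_real r) / 2) {0..b}"
proof -
  have "((\<lambda>u. complex_of_real (u\<^sup>2 * (2 * r * sin (2 * u) / (1 - 2 * r * cos (2 * u) + r\<^sup>2)))) has_integral
    clausen_prim r (of_real b) - clausen_prim r (of_real 0)) {0..b}"
  proof (rule fundamental_theorem_of_calculus[OF assms(3)])
    fix u
    have "- \<i> * of_real (u\<^sup>2) * (polylog 0 (circ r (of_real u)) - polylog 0 (circ r (- of_real u)))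
        = complex_of_real (u\<^sup>2 * (2 * r * sin (2 * u) / (1 - 2 * r * cos (2 * u) + r\<^sup>2)))"
      using arg_cong[OF polylog_0_circ_diff[of r u], of "\<lambda>x. of_real (u\<^sup>2) * x"] assms
      by (simp add: mult_ac)
    then show "((\<lambda>u. clausen_prim r (of_real u)) has_vector_derivative
        complex_of_real (u\<^sup>2 * (2 * r * sin (2 * u) / (1 - 2 * r * cos (2 * u) + r\<^sup>2)))) (at u within {0..b})"
      using has_vector_derivative_real_field[OF DERIV_clausen_prim[of r u]] assms by simp
  qed
  moreover have "clausen_prim r (of_real 0) = polylog 3 (of_real r) / 2"
    by (simp add: clausen_prim_def circ_def)
  ultimately show ?thesis
    by (simp only:)
qed

section \<open>Domination and passage to the unit circle\<close>

text \<open>This form shows the lower bound 4 r (sin u)^2 and the value 4 (sin u)^2 at r =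
  1.\<close>

lemma poisson_denominator: "1 - 2 * r * cos (2 * u) + r\<^sup>2 = (1 - r)\<^sup>2 + 4 * r * (sin u)\<^sup>2"
  for r u :: real
  unfolding cos_double_sin by (simp add: power2_eq_square algebra_simps)

text \<open>Dropping (1-r)^2 from the denominator turns the kernel into exactly cot u, a majorant
  independent of r. At u = 0 both sides vanish.\<close>

lemma clausen_integrand_bounds:
  fixes r u :: real
  assumes "0 < r" "r < 1" "0 \<le> u" "u \<le> pi / 2"
  shows "\<bar>u\<^sup>2 * (2 * r * sin (2 * u) / (1 - 2 * r * cos (2 * u) + r\<^sup>2))\<bar> \<le> u\<^sup>2 * cot u"
proof (cases "u = 0")
  case False
  then have "sin u > 0" "cos u \<ge> 0"
    using assms by (auto intro!: sin_gt_zero cos_ge_zero)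
  then have "2 * r * sin (2 * u) / (1 - 2 * r * cos (2 * u) + r\<^sup>2) \<le> 2 * r * sin (2 * u) / (4 * r * (sin u)\<^sup>2)"
    unfolding poisson_denominator sin_double using assms
    by (intro divide_left_mono) (auto intro!: mult_pos_pos add_nonneg_pos)
  also have "\<dots> = cot u"
    using \<open>sin u > 0\<close> assms by (simp add: cot_def sin_double power2_eq_square)
  finally have "2 * r * sin (2 * u) / (1 - 2 * r * cos (2 * u) + r\<^sup>2) \<le> cot u" .
  moreover have "0 \<le> 2 * r * sin (2 * u) / (1 - 2 * r * cos (2 * u) + r\<^sup>2)"
    unfolding poisson_denominator sin_double using assms \<open>sin u > 0\<close> \<open>cos u \<ge> 0\<close> by simp
  moreover have "\<bar>u\<^sup>2 * x\<bar> \<le> u\<^sup>2 * c" if "x \<le> c" "0 \<le> x" for x c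
    using that by (simp add: abs_mult mult_left_mono)
  ultimately show ?thesis
    by blast
qed simp

text \<open>Positive real part keeps z off the branch cut, so \<open>Ln\<close> commutes with
  conjugation and the imaginary parts cancel.\<close>

lemma Ln_sum_cnj:
  assumes "Re z > 0"
  shows "Ln z + Ln (cnj z) = of_real (2 * ln (norm z))"
proof -
  have "z \<notin> \<real>\<^sub>\<le>\<^sub>0" "z \<noteq> 0"
    using assms by (auto simp: complex_nonpos_Reals_iff)
  then have "Ln z + Ln (cnj z) = Ln z + cnj (Ln z)"
    by (simp add: cnj_Ln)
  also have "\<dots> = of_real (2 * ln (norm z))"
    using \<open>z \<noteq> 0\<close> by (simp add: complex_add_cnj)
  finally show ?thesis .
qed

text \<open>Orders 2 and 3 converge by continuity on the closed disc. Order 1 is handled through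
  \<open>Ln\<close>, which is continuous at 1 - e^(2ib) because its real part is positive for these
  b.\<close>

lemma clausen_prim_tendsto:
  assumes r: "r \<longlonglongrightarrow> 1" "\<And>n. 0 < r n" "\<And>n. r n < 1" and b: "0 < b" "b \<le> pi / 2"
  shows "(\<lambda>n. clausen_prim (r n) (of_real b)) \<longlonglongrightarrow>
    (polylog 3 (exp (2 * \<i> * of_real b)) + polylog 3 (exp (- 2 * \<i> * of_real b))) / 4
     + of_real b * ((polylog 2 (exp (2 * \<i> * of_real b)) - polylog 2 (exp (- 2 * \<i> * of_real b))) / (2 * \<i>))
     + of_real (b\<^sup>2 * ln (2 * sin b))"
proof -
  have norm_exp: "norm (exp (2 * \<i> * of_real t)) = 1" for t
    by (simp add: norm_exp_eq_Re)
  have circ_lim: "(\<lambda>n. circ (r n) t) \<longlonglongrightarrow> exp (2 * \<i> * t)" for t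
    unfolding circ_def using tendsto_mult[OF tendsto_of_real[OF r(1)] tendsto_const] by simp
  have polylog_lim: "(\<lambda>n. polylog k (circ (r n) (of_real t))) \<longlonglongrightarrow> polylog k (exp (2 * \<i> * of_real t))"
    if "k \<ge> 2" for k t
    by (rule continuous_on_tendsto_compose[OF continuous_on_polylog[OF that] circ_lim])
      (use r(2,3) norm_exp[of t] in \<open>auto intro!: always_eventually less_imp_le simp: abs_of_pos\<close>)
  note polylog_lim = this this[where t = "- t" for t, simplified]
  have exp_b: "exp (2 * \<i> * of_real b) = cis (2 * b)" "exp (2 * \<i> * - of_real b) = cnj (cis (2 * b))"
    by (simp_all add: cis_conv_exp exp_cnj mult_ac)
  have "cos (2 * b) < 1"
    using b sin_gt_zero[of b] by (simp add: cos_double_sin)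
  then have Re_pos: "Re (1 - cis (2 * b)) > 0"
    by simp
  have log_lim: "(\<lambda>n. polylog 1 (circ (r n) (of_real b)) + polylog 1 (circ (r n) (- of_real b)))
      \<longlonglongrightarrow> - of_real (2 * ln (2 * sin b))"
  proof -
    have "(\<lambda>n. - Ln (1 - circ (r n) (of_real b)) + - Ln (1 - circ (r n) (- of_real b)))
        \<longlonglongrightarrow> - Ln (1 - cis (2 * b)) + - Ln (1 - cnj (cis (2 * b)))"
      using circ_lim[of "of_real b"] circ_lim[of "- of_real b"] unfolding exp_b
      by (intro tendsto_intros) (use Re_pos in \<open>auto simp: complex_nonpos_Reals_iff\<close>)
    moreover have "polylog 1 (circ (r n) (of_real b)) = - Ln (1 - circ (r n) (of_real b))"
      "polylog 1 (circ (r n) (- of_real b)) = - Ln (1 - circ (r n) (- of_real b))" for n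
      using r(2,3)[of n] by (intro polylog_1_complex; simp)+
    moreover have "- Ln (1 - cis (2 * b)) + - Ln (1 - cnj (cis (2 * b))) = - of_real (2 * ln (2 * sin b))"
    proof -
      \<comment> \<open>The chord of the unit circle subtending the angle 2b has length 2 sin
        b.\<close>
      have "norm (1 - cis (2 * b)) = 2 * sin b"
        using dist_exp_i_1[of "2 * b"] b sin_ge_zero[of b]
        by (simp add: cis_conv_exp norm_minus_commute)
      with Ln_sum_cnj[OF Re_pos] show ?thesis
        by (simp add: algebra_simps)
    qed
    ultimately show ?thesis
      by simp
  qed
  have "(\<lambda>n. clausen_prim (r n) (of_real b)) \<longlonglongrightarrow>
    (polylog 3 (exp (2 * \<i> * of_real b)) + polylog 3 (exp (- 2 * \<i> * of_real b))) / 4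
     + of_real b * ((polylog 2 (exp (2 * \<i> * of_real b)) - polylog 2 (exp (- 2 * \<i> * of_real b))) / (2 * \<i>))
     - (of_real b)\<^sup>2 / 2 * (- of_real (2 * ln (2 * sin b)))"
    unfolding clausen_prim_def using polylog_lim[of 2] polylog_lim[of 3]
    by (intro tendsto_intros log_lim) simp_all
  then show ?thesis
    by simp
qed

lemma polylog_at_1: "polylog k 1 = complex_of_real (zeta_nat k)" if "k \<ge> 2"
proof -
  have "(\<lambda>n. complex_of_real (1 / real (Suc n) ^ k)) sums complex_of_real (zeta_nat k)"
    unfolding zeta_nat_def using summable_inverse_Suc_power[OF that]
    by (intro sums_of_real summable_sums)
  then show ?thesis
    by (simp add: polylog_def sums_iff)
qed

lemma S_int_diagonal:
  assumes "0 < v" "v \<le> 1"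
  shows "complex_of_real (S_int v v) =
           (polylog 3 (exp (2 * \<i> * of_real (arcsin v))) + polylog 3 (exp (- 2 * \<i> * of_real (arcsin v)))) / 4
           - complex_of_real (zeta_nat 3) / 2
           + of_real (arcsin v)
             * ((polylog 2 (exp (2 * \<i> * of_real (arcsin v)))
                 - polylog 2 (exp (- 2 * \<i> * of_real (arcsin v)))) / (2 * \<i>))
           + of_real ((arcsin v)\<^sup>2 * ln (2 * v))"
proof -
  define b where "b = arcsin v"
  have b: "0 < b" "b \<le> pi / 2" "sin b = v"
    using assms arcsin_less_arcsin[of 0 v] arcsin_ubound[of v] by (auto simp: b_def)
  \<comment> \<open>A sequence in (0, 1) tending to 1; the summand 2 makes it start at 1/2, which
    keeps it positive.\<close>
  define r where "r n = 1 - 1 / (real n + 2)" for n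
  have r: "r \<longlonglongrightarrow> 1" "\<And>n. 0 < r n" "\<And>n. r n < 1"
    unfolding r_def by real_asymp (simp_all add: field_simps)
  let ?f = "\<lambda>n u. u\<^sup>2 * (2 * r n * sin (2 * u) / (1 - 2 * r n * cos (2 * u) + (r n)\<^sup>2))"
  have f: "((\<lambda>u. complex_of_real (?f n u)) has_integral
      clausen_prim (r n) (of_real b) - polylog 3 (of_real (r n)) / 2) {0..b}" for n
    using r b by (intro clausen_prim_has_integral) auto
  have cot: "((\<lambda>u. u\<^sup>2 * cot u) has_integral S_int v v) {0..b}"
    unfolding b_def by (rule integral_arcsin_sq_substitution[OF assms])
  have "(\<lambda>n. integral {0..b} (\<lambda>u. complex_of_real (?f n u))) \<longlonglongrightarrow>
      integral {0..b} (\<lambda>u. complex_of_real (u\<^sup>2 * cot u))"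
  \<comment> \<open>The majorant u^2 cot u is integrable by the substitution lemma and is also the
    pointwise limit.\<close>
  proof (rule dominated_convergence(2))
    show "(\<lambda>u. complex_of_real (?f n u)) integrable_on {0..b}" for n
      using f by (rule has_integral_integrable)
    show "(\<lambda>u. u\<^sup>2 * cot u) integrable_on {0..b}"
      using cot by (rule has_integral_integrable)
    fix u assume u: "u \<in> {0..b}"
    show "norm (complex_of_real (?f n u)) \<le> u\<^sup>2 * cot u" for n
      unfolding norm_of_real using r u b by (intro clausen_integrand_bounds) auto
    show "(\<lambda>n. complex_of_real (?f n u)) \<longlonglongrightarrow> complex_of_real (u\<^sup>2 * cot u)"
    proof (cases "u = 0")
      case False
      then have "sin u > 0"
        using u b by (intro sin_gt_zero) auto
      then have "2 * 1 * sin (2 * u) / (1 - 2 * 1 * cos (2 * u) + 1\<^sup>2) = cot u"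
        unfolding poisson_denominator by (simp add: cot_def sin_double power2_eq_square)
      moreover have "(\<lambda>n. 2 * r n * sin (2 * u) / (1 - 2 * r n * cos (2 * u) + (r n)\<^sup>2)) \<longlonglongrightarrow>
          2 * 1 * sin (2 * u) / (1 - 2 * 1 * cos (2 * u) + 1\<^sup>2)"
        using \<open>sin u > 0\<close> poisson_denominator[of 1 u] by (intro tendsto_intros r) simp
      ultimately show ?thesis
        by (intro tendsto_of_real tendsto_mult tendsto_const) simp
    qed simp
  qed
  moreover have "integral {0..b} (\<lambda>u. complex_of_real (u\<^sup>2 * cot u)) = of_real (S_int v v)"
    using integral_unique[OF has_integral_linear[OF cot bounded_linear_of_real]] by (simp only: o_def)
  ultimately have S_lim: "(\<lambda>n. clausen_prim (r n) (of_real b) - polylog 3 (of_real (r n)) / 2)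
      \<longlonglongrightarrow> complex_of_real (S_int v v)"
    by (simp only: integral_unique[OF f])
  have "(\<lambda>n. polylog 3 (complex_of_real (r n))) \<longlonglongrightarrow> polylog 3 (of_real 1)"
    using r(2,3) by (intro continuous_on_tendsto_compose[OF continuous_on_polylog] tendsto_of_real r(1))
      (auto intro!: always_eventually less_imp_le simp: abs_of_pos)
  then have "(\<lambda>n. polylog 3 (complex_of_real (r n))) \<longlonglongrightarrow> of_real (zeta_nat 3)"
    by (simp add: polylog_at_1)
  \<comment> \<open>One sequence has two limits: the integral by dominated convergence and the
    closed form by continuity of its summands.\<close>
  note LIMSEQ_unique[OF S_lim tendsto_diff[OF clausen_prim_tendsto[OF r b(1,2)]
    tendsto_divide[OF this tendsto_const[of 2] zero_neq_numeral[symmetric]]]]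
  moreover have "p + q + t - z = p - z + q + t" for p q t z :: complex
    by simp
  ultimately show ?thesis
    unfolding b_def[symmetric] \<open>sin b = v\<close> by (simp only:)
qed

theorem theorem5p1:
  fixes v :: real
  assumes "0 \<le> v" and "v \<le> 1"
  shows "S_int v 1 = pi / 2 * integral {0..v} (\<lambda>x. arcsin x / x)
           - (polylog 3 v - polylog 3 (- v)) / 2
    \<and> complex_of_real (S_int v v) =
           (polylog 3 (exp (2 * \<i> * complex_of_real (arcsin v)))
             + polylog 3 (exp (- 2 * \<i> * complex_of_real (arcsin v)))) / 4
           - complex_of_real (zeta_nat 3) / 2
           + complex_of_real (arcsin v)
             * ((polylog 2 (exp (2 * \<i> * complex_of_real (arcsin v)))
                 - polylog 2 (exp (- 2 * \<i> * complex_of_real (arcsin v)))) / (2 * \<i>))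
           + complex_of_real ((arcsin v)\<^sup>2 * ln (2 * v))"
proof (cases "v = 0")
  case True
  \<comment> \<open>At v = 0 both exponentials are 1, so the trilogarithms sum to zeta(3)/2 and
    cancel; the other summands carry a factor arcsin 0.\<close>
  have "S_int 0 0 = 0"
    by (simp add: S_int_def)
  then show ?thesis
    using S_int_1[of v] True by (simp add: polylog_at_1)
next
  case False
  then show ?thesis
    using S_int_1 S_int_diagonal assms by simp
qed

end
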